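(* Let $r\ge2$ be an integer. For all words $u,v\in\{0,1\}^*$ (finite, possibly empty), the following identities hold in $\mathbb Z[a,b,q]$: $$[u10v]_r=q[u01v]_r+r[u1v]_r+r[u0v]_r,\qquad [0v]_r=a[v]_r,\qquad [u1]_r=b(r-1)[u]_r.$$
   Context: An alternative tree on a finite nonempty totally ordered set $S$ is an unordered rooted tree with vertex set $S$ such that (i) the root is $\min S$ or $\max S$; (ii) a vertex larger than its parent is larger than all its descendants; (iii) a vertex smaller than its parent is smaller than all its descendants. For $n\ge0$ and $r\ge2$, let $\mathcal O_n^r$ be the set of decorated alternative trees on $\{0,1,\ldots,n+1\}$ with root $0$: alternative trees with root $0$ in which each vertex additionally receives a color in $\{0,\ldots,r-1\}$ such that (a) all children of the root $0$ have color $0$; (b) for each child $c$ of $n+1$, the largest vertex of the maximal subtree rooted at $c$ has non-zero color; (c) the root $0$ has color $1$ and $n+1$ has color $0$. For $\mathcal T\in\mathcal O_n^r$ let $p(i)$ be the parent of non-root vertex $i$; $i$ is an excedance if $i<p(i)$; $\mathcal X(\mathcal T)\in\{0,1\}^n$ has $\mathcal X(\mathcal T)(i)=1$ iff $i\in[n]$ is an excedance; $\mathrm{yy}(\mathcal T)$ is the number of pairs $1\le i<j\le n$ with $p(j)<i<j<p(i)$; $c_0(\mathcal T)$ is the number of children of $0$ minus one and $c_1(\mathcal T)$ the number of children of $n+1$. For indeterminates $a,b,q$ and $\eta\in\{0,1\}^n$ define $$[\eta]_r=\sum a^{c_0(\mathcal T)}b^{c_1(\mathcal T)}q^{\mathrm{yy}(\mathcal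 T)},$$ the sum over all $\mathcal T\in\bigcup_{n\ge0}\mathcal O_n^r$ with $\mathcal X(\mathcal T)=\eta$. *)

theory Defs
  imports Complex_Main "HOL-Library.FuncSet" "HOL-Library.Poly_Mapping"
begin

text \<open>
  An unordered rooted tree with vertex set \<open>S\<close> and root \<open>\<rho>\<close> is given by its set of edges,
  each oriented towards the root: \<open>(x, y) \<in> E\<close> means that \<open>y\<close> is the parent of \<open>x\<close>.
  For fixed \<open>S\<close>, distinct pairs \<open>(\<rho>, E)\<close> are distinct rooted trees, so nothing is counted twice.
\<close>

definition rooted_tree :: "'a set \<Rightarrow> 'a \<Rightarrow> ('a \<times> 'a) set \<Rightarrow> bool" where
  "rooted_tree S \<rho> E \<longleftrightarrow>
     E \<subseteq> S \<times> S \<and> \<rho> \<in> S \<and>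
     (\<forall>y. (\<rho>, y) \<notin> E) \<and>
     (\<forall>x \<in> S - {\<rho>}. \<exists>!y. (x, y) \<in> E) \<and>
     (\<forall>x \<in> S. (x, \<rho>) \<in> E\<^sup>*)"

definition parent :: "('a \<times> 'a) set \<Rightarrow> 'a \<Rightarrow> 'a" where
  "parent E x = (THE y. (x, y) \<in> E)"

definition children :: "('a \<times> 'a) set \<Rightarrow> 'a \<Rightarrow> 'a set" where
  "children E x = {c. (c, x) \<in> E}"

definition descendants :: "('a \<times> 'a) set \<Rightarrow> 'a \<Rightarrow> 'a set" where
  "descendants E x = {d. (d, x) \<in> E\<^sup>+}"

definition subtree_vertices :: "('a \<times> 'a) set \<Rightarrow> 'a \<Rightarrow> 'a set" where
  "subtree_vertices E x = insert x (descendants E x)"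

definition alternative_tree :: "'a::linorder set \<Rightarrow> 'a \<Rightarrow> ('a \<times> 'a) set \<Rightarrow> bool" where
  "alternative_tree S \<rho> E \<longleftrightarrow>
     finite S \<and> S \<noteq> {} \<and> rooted_tree S \<rho> E \<and>
     (\<rho> = Min S \<or> \<rho> = Max S) \<and>
     (\<forall>x \<in> S - {\<rho>}. x > parent E x \<longrightarrow> (\<forall>d \<in> descendants E x. x > d)) \<and>
     (\<forall>x \<in> S - {\<rho>}. x < parent E x \<longrightarrow> (\<forall>d \<in> descendants E x. x < d))"

text \<open>
  A coloured tree on \<open>{0..n+1}\<close>; the number \<open>n\<close> is the field \<open>inner\<close>.
\<close>

record col_tree =
  inner :: nat
  edges :: "(nat \<times> nat) set"
  col :: "nat \<Rightarrow> nat"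

text \<open>
  The colouring is extensional (\<open>\<rightarrow>\<^sub>E\<close>): only its values on the vertices matter for
  equality of decorated trees.
\<close>

definition decorated_trees :: "nat \<Rightarrow> nat \<Rightarrow> col_tree set" where
  "decorated_trees r n = {T.
     inner T = n \<and>
     alternative_tree {0..n + 1} 0 (edges T) \<and>
     col T \<in> {0..n + 1} \<rightarrow>\<^sub>E {0..<r} \<and>
     (\<forall>c \<in> children (edges T) 0. col T c = 0) \<and>
     (\<forall>c \<in> children (edges T) (n + 1). col T (Max (subtree_vertices (edges T) c)) \<noteq> 0) \<and>
     col T 0 = 1 \<and> col T (n + 1) = 0}"

definition excedance_word :: "col_tree \<Rightarrow> nat list" where
  "excedance_word T = map (\<lambda>i. if i < parent (edges T) i then 1 else 0) [1..<inner T + 1]"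

definition yy :: "col_tree \<Rightarrow> nat" where
  "yy T = card {(i, j). 1 \<le> i \<and> i < j \<and> j \<le> inner T \<and>
     parent (edges T) j < i \<and> j < parent (edges T) i}"

text \<open>
  The truncated subtraction is harmless: \<open>n + 1\<close> is always a child of the root \<open>0\<close>.
\<close>

definition c0 :: "col_tree \<Rightarrow> nat" where
  "c0 T = card (children (edges T) 0) - 1"

definition c1 :: "col_tree \<Rightarrow> nat" where
  "c1 T = card (children (edges T) (inner T + 1))"

text \<open>
  The ring \<open>\<int>[a,b,q]\<close>: finitely supported maps from monomials (exponent vectors in the three
  indeterminates) to integer coefficients, with convolution as multiplication.
\<close>

datatype indet = A | B | Q

type_synonym zpoly = "(indet \<Rightarrow>\<^sub>0 nat) \<Rightarrow>\<^sub>0 int"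

definition indeterminate :: "indet \<Rightarrow> zpoly" where
  "indeterminate x = Poly_Mapping.single (Poly_Mapping.single x 1) 1"

abbreviation pa :: zpoly where "pa \<equiv> indeterminate A"
abbreviation pb :: zpoly where "pb \<equiv> indeterminate B"
abbreviation pq :: zpoly where "pq \<equiv> indeterminate Q"

definition bracket :: "nat \<Rightarrow> nat list \<Rightarrow> zpoly" where
  "bracket r \<eta> =
     (\<Sum>T \<in> {T \<in> (\<Union>n. decorated_trees r n). excedance_word T = \<eta>}.
        pa ^ c0 T * pb ^ c1 T * pq ^ yy T)"

text \<open>
  The index set of the sum is finite, so the sum never takes the default value \<open>0\<close> of an
  infinite sum.
\<close>

lemma finite_bracket_index:
  "finite {T \<in> (\<Union>n. decorated_trees r n). excedance_word T = \<eta>}"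
proof -
  let ?V = "{0..length \<eta> + 1}"
  let ?mk = "\<lambda>(E, k). \<lparr>inner = length \<eta>, edges = E, col = k\<rparr>"
  have "{T \<in> (\<Union>n. decorated_trees r n). excedance_word T = \<eta>}
          \<subseteq> ?mk ` (Pow (?V \<times> ?V) \<times> (?V \<rightarrow>\<^sub>E {0..<r}))"
  proof
    fix T :: col_tree
    assume "T \<in> {T \<in> (\<Union>n. decorated_trees r n). excedance_word T = \<eta>}"
    then have T: "T \<in> decorated_trees r (inner T)" and w: "excedance_word T = \<eta>"
      by (auto simp: decorated_trees_def)
    have n: "inner T = length \<eta>"
      using w by (auto simp: excedance_word_def)
    have "(edges T, col T) \<in> Pow (?V \<times> ?V) \<times> (?V \<rightarrow>\<^sub>E {0..<r})"
      using T unfolding n by (simp add: decorated_trees_def alternative_tree_def rooted_tree_def)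
    moreover have "T = ?mk (edges T, col T)"
      using n by simp
    ultimately show "T \<in> ?mk ` (Pow (?V \<times> ?V) \<times> (?V \<rightarrow>\<^sub>E {0..<r}))"
      by (rule rev_image_eqI)
  qed
  moreover have "finite (Pow (?V \<times> ?V) \<times> (?V \<rightarrow>\<^sub>E {0..<r}))"
    by (intro finite_cartesian_product finite_PiE) auto
  ultimately show ?thesis
    using finite_subset by blast
qed

end

theory Submission
  imports Defs "HOL-Combinatorics.Transposition"
begin

text \<open>
  Alternation with root \<open>0\<close> is a local condition on the parent function: the vertex \<open>n + 1\<close> is a
  child of \<open>0\<close>, excedances and non-excedances alternate along every path to the root, and the
  grandparent of an excedance (non-excedance) is smaller (larger) than it.

  Given the tree, the colours can be chosen independently at all vertices: the children of \<open>0\<close> are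
  forced, the maxima of the subtrees at the children of \<open>n + 1\<close> have \<open>r - 1\<close> choices, and all other
  inner vertices have \<open>r\<close>. Hence \<open>[\<eta>]\<^sub>r\<close> is a sum over uncoloured trees in which a vertex has weight
  \<open>a\<close>, \<open>b (r - 1)\<close> or \<open>r\<close> according to whether its parent is \<open>0\<close>, \<open>n + 1\<close> or another vertex.

  For the first identity look at the adjacent vertices \<open>k\<close> (excedance) and \<open>k + 1\<close>
  (non-excedance). If neither is the parent of the other, exchanging their labels removes exactly
  the pair \<open>(k, k + 1)\<close> from \<open>yy\<close>. Otherwise the one which is a child of the other is a leaf
  that occurs in no pair counted by \<open>yy\<close>, and deleting it costs a factor \<open>r\<close>. In the other two
  identities the first or last vertex is a leaf attached to \<open>0\<close> or \<open>n + 1\<close>.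
\<close>

subsection \<open>Alternative trees as parent functions\<close>

text \<open>Only inner vertices carry a parent, since \<open>0\<close> is the root and the parent of
  \<open>n + 1\<close> is always \<open>0\<close>. The escape clauses \<open>p i = n + 1\<close> and
  \<open>p i = 0\<close> stop the grandparent condition where \<open>p (p i)\<close> would leave the
  domain.\<close>

definition ptree :: "nat \<Rightarrow> (nat \<Rightarrow> nat) \<Rightarrow> bool" where
  "ptree n p \<longleftrightarrow> p \<in> {1..n} \<rightarrow>\<^sub>E {0..n + 1} \<and>
     (\<forall>i\<in>{1..n}. p i \<noteq> i \<and> (i < p i \<longrightarrow> p i = n + 1 \<or> p (p i) < i) \<and>
                       (p i < i \<longrightarrow> p i = 0 \<or> i < p (p i)))"

definition pword :: "nat \<Rightarrow> (nat \<Rightarrow> nat) \<Rightarrow> nat list" where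
  "pword n p = map (\<lambda>i. if i < p i then 1 else 0) [1..<n + 1]"

definition crossings :: "nat \<Rightarrow> (nat \<Rightarrow> nat) \<Rightarrow> nat" where
  "crossings n p = card {(i, j). 1 \<le> i \<and> i < j \<and> j \<le> n \<and> p j < i \<and> j < p i}"

definition weight :: "'a::comm_ring_1 \<Rightarrow> 'a \<Rightarrow> 'a \<Rightarrow> nat \<Rightarrow> (nat \<Rightarrow> nat) \<Rightarrow> 'a" where
  "weight x y z n p = (\<Prod>i\<in>{1..n}. if p i = 0 then x else if p i = n + 1 then y else z)"

definition ptree_sum :: "'a::comm_ring_1 \<Rightarrow> 'a \<Rightarrow> 'a \<Rightarrow> 'a \<Rightarrow> nat list \<Rightarrow> 'a" where
  "ptree_sum x y z q \<eta> = (\<Sum>p | ptree (length \<eta>) p \<and> pword (length \<eta>) p = \<eta>.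
     weight x y z (length \<eta>) p * q ^ crossings (length \<eta>) p)"

lemma finite_ptree: "finite {p. ptree n p \<and> P p}"
proof (rule finite_subset)
  show "{p. ptree n p \<and> P p} \<subseteq> {1..n} \<rightarrow>\<^sub>E {0..n + 1}"
    by (auto simp: ptree_def)
qed (intro finite_PiE; simp)

lemma pword_eq_iff:
  "pword n p = \<eta> \<longleftrightarrow> length \<eta> = n \<and> (\<forall>i\<in>{1..n}. \<eta> ! (i - 1) = (if i < p i then 1 else 0))"
proof
  assume R: "length \<eta> = n \<and> (\<forall>i\<in>{1..n}. \<eta> ! (i - 1) = (if i < p i then 1 else 0))"
  show "pword n p = \<eta>"
  proof (rule nth_equalityI)
    show "length (pword n p) = length \<eta>"
      using R by (simp add: pword_def)
    fix i assume "i < length (pword n p)"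
    then have i: "i < n"
      by (simp add: pword_def del: upt_Suc)
    then have "\<eta> ! (Suc i - 1) = (if Suc i < p (Suc i) then 1 else 0)"
      using R by (metis One_nat_def Suc_leI atLeastAtMost_iff le_numeral_extra(4) Suc_le_mono le0)
    then show "pword n p ! i = \<eta> ! i"
      using i by (simp add: pword_def nth_append del: upt_Suc)
  qed
qed (auto simp: pword_def simp del: upt_Suc)

subsection \<open>Deleting a leaf\<close>

text \<open>The increasing injection of the naturals whose image misses exactly
  \<open>k\<close>.\<close>

definition skip :: "nat \<Rightarrow> nat \<Rightarrow> nat" where
  "skip k i = (if i < k then i else Suc i)"

definition unskip :: "nat \<Rightarrow> nat \<Rightarrow> nat" where
  "unskip k i = (if i \<le> k then i else i - 1)"

lemma skip_less [simp]: "skip k i < skip k j \<longleftrightarrow> i < j"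
  and skip_eq [simp]: "skip k i = skip k j \<longleftrightarrow> i = j"
  and skip_neq [simp]: "skip k i \<noteq> k" "k \<noteq> skip k i"
  and unskip_skip [simp]: "unskip k (skip k i) = i"
  and skip_unskip: "j \<noteq> k \<Longrightarrow> skip k (unskip k j) = j"
  by (auto simp: skip_def unskip_def)

lemma skip_image:
  assumes "1 \<le> k" "k \<le> Suc n"
  shows "{1..Suc n} = insert k (skip k ` {1..n})"
proof -
  have "j \<in> skip k ` {1..n}" if "j \<in> {1..Suc n}" "j \<noteq> k" for j
    using that assms by (intro image_eqI[where x = "unskip k j"]) (auto simp: skip_def unskip_def)
  moreover have "insert k (skip k ` {1..n}) \<subseteq> {1..Suc n}"
    using assms by (auto simp: skip_def)
  ultimately show ?thesis
    by blast
qed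

text \<open>\<open>p\<close> is \<open>p'\<close> with a vertex \<open>k\<close> attached to a
  neighbouring label \<open>t\<close>. The last assumption makes \<open>k\<close> a leaf, because
  \<open>skip k\<close> never takes the value \<open>k\<close>. Stated as a relation between
  \<open>p\<close> and \<open>p'\<close>, the same facts serve insertion and deletion.\<close>

locale leaf_insertion =
  fixes n k t :: nat and p p' :: "nat \<Rightarrow> nat"
  assumes k: "1 \<le> k" "k \<le> Suc n"
    and pk: "p k = t"
    and adjacent: "t = Suc k \<or> k = Suc t"
    and ps: "\<And>i. i \<in> {1..n} \<Longrightarrow> p (skip k i) = skip k (p' i)"
begin

lemma skip_0 [simp]: "skip k i = 0 \<longleftrightarrow> i = 0"
  and skip_top [simp]: "skip k i = Suc (Suc n) \<longleftrightarrow> i = Suc n"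
  using k by (auto simp: skip_def)

lemma weight_insert:
  "weight x y z (Suc n) p = (if t = 0 then x else if t = n + 2 then y else z) * weight x y z n p'"
proof -
  have "inj_on (skip k) {1..n}" "k \<notin> skip k ` {1..n}"
    by (auto simp: inj_on_def)
  moreover have "(\<Prod>i\<in>{1..n}. if p (skip k i) = 0 then x else if p (skip k i) = Suc n + 1 then y else z)
      = (\<Prod>i\<in>{1..n}. if p' i = 0 then x else if p' i = n + 1 then y else z)"
    by (intro prod.cong refl) (simp add: ps)
  ultimately show ?thesis
    unfolding weight_def skip_image[OF k] by (simp add: prod.reindex pk)
qed

text \<open>No pair containing \<open>k\<close> is counted: as second entry it would need some
  \<open>i\<close> strictly between \<open>t\<close> and \<open>k\<close>, as first entry some
  \<open>j\<close> strictly between \<open>k\<close> and \<open>t\<close>, and adjacent labels leave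
  no room. The other pairs correspond under the order embedding \<open>skip k\<close>.\<close>

lemma crossings_insert: "crossings (Suc n) p = crossings n p'"
proof -
  have "{(i, j). 1 \<le> i \<and> i < j \<and> j \<le> Suc n \<and> p j < i \<and> j < p i}
      = map_prod (skip k) (skip k) ` {(i, j). 1 \<le> i \<and> i < j \<and> j \<le> n \<and> p' j < i \<and> j < p' i}"
    (is "?L = _ ` ?R")
  proof (intro equalityI subsetI)
    fix z assume "z \<in> ?L"
    then obtain i j where z: "z = (i, j)" and ij: "1 \<le> i" "i < j" "j \<le> Suc n" "p j < i" "j < p i"
      by auto
    have "i \<noteq> k" "j \<noteq> k"
      using ij pk adjacent by auto
    moreover have "i \<in> {1..Suc n}" "j \<in> {1..Suc n}"
      using ij by auto
    ultimately obtain i' j' where "i' \<in> {1..n}" "j' \<in> {1..n}" "i = skip k i'" "j = skip k j'"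
      unfolding skip_image[OF k] by auto
    then show "z \<in> map_prod (skip k) (skip k) ` ?R"
      using ij z by (intro image_eqI[where x = "(i', j')"]) (auto simp: ps)
  next
    fix z assume "z \<in> map_prod (skip k) (skip k) ` ?R"
    then obtain i j where z: "z = (skip k i, skip k j)"
      and ij: "1 \<le> i" "i < j" "j \<le> n" "p' j < i" "j < p' i"
      by auto
    then show "z \<in> ?L"
      by (auto simp: ps) (auto simp: skip_def)
  qed
  moreover have "inj_on (map_prod (skip k) (skip k)) A" for A
    by (auto simp: inj_on_def)
  ultimately show ?thesis
    by (simp add: crossings_def card_image)
qed

lemma pword_insert:
  assumes "length u = k - 1" "length v = Suc n - k"
  shows "pword (Suc n) p = u @ [if k < t then 1 else 0] @ v \<longleftrightarrow> pword n p' = u @ v"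
proof -
  let ?w = "u @ [if k < t then 1 else 0] @ v"
  have "?w ! (skip k i - 1) = (u @ v) ! (i - 1)" if "i \<in> {1..n}" for i
    using that assms k by (auto simp: nth_append skip_def Suc_diff_le)
  then have "(\<forall>i\<in>{1..n}. ?w ! (skip k i - 1) = (if skip k i < p (skip k i) then 1 else 0))
      \<longleftrightarrow> (\<forall>i\<in>{1..n}. (u @ v) ! (i - 1) = (if i < p' i then 1 else 0))"
    by (intro ball_cong refl) (simp only: ps skip_less)
  moreover have "?w ! (k - 1) = (if k < p k then 1 else 0)"
    using assms by (simp add: nth_append pk)
  moreover have "length ?w = Suc n \<and> length (u @ v) = n"
    using assms k by auto
  ultimately show ?thesis
    unfolding pword_eq_iff skip_image[OF k] ball_simps by blast
qed

text \<open>Away from \<open>k\<close> the tree condition transfers because \<open>skip k\<close>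
  preserves order. The condition at \<open>k\<close> is encoded by \<open>nbr\<close>: for
  \<open>t = k + 1\<close> the parent of \<open>k\<close> is the vertex called \<open>k\<close> in
  \<open>p'\<close> and must be a non-excedance there; for \<open>k = t + 1\<close> it keeps its
  label \<open>t\<close> and must be an excedance. Boundary parents are exempt.\<close>

lemma ptree_insert:
  assumes p: "p \<in> extensional {1..Suc n}" and p': "p' \<in> extensional {1..n}"
    and nbr: "t = Suc k \<Longrightarrow> t = n + 2 \<or> p' k \<le> k"
      "k = Suc t \<Longrightarrow> t = 0 \<or> t \<le> p' t"
  shows "ptree (Suc n) p \<longleftrightarrow> ptree n p'"
proof
  let ?c = "\<lambda>n p i. p i \<noteq> i \<and> (i < p i \<longrightarrow> p i = n + 1 \<or> p (p i) < i) \<and>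
                       (p i < i \<longrightarrow> p i = 0 \<or> i < (p::nat\<Rightarrow>nat) (p i))"
  \<comment> \<open>Parents \<open>0\<close> and \<open>n + 1\<close> are treated apart, as
    \<open>ps\<close> covers inner vertices only; \<open>skip k\<close> sends them to the boundary
    \<open>0\<close> and \<open>n + 2\<close> of the larger tree.\<close>
  have step: "?c (Suc n) p (skip k i) \<longleftrightarrow> ?c n p' i" if "i \<in> {1..n}" "p' i \<le> n + 1" for i
  proof (cases "p' i \<in> {1..n}")
    case True
    then show ?thesis
      using that by (simp add: ps)
  next
    case False
    then have "p' i = 0 \<or> p' i = n + 1"
      using that by auto
    moreover have "0 < skip k i" "skip k i < n + 2"
      using that k by (auto simp: skip_def)
    ultimately show ?thesis
      using that by (auto simp: ps)
  qed
  {
    assume P: "ptree (Suc n) p"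
    have rng: "p' i \<le> n + 1" if "i \<in> {1..n}" for i
    proof -
      have "skip k i \<in> {1..Suc n}"
        using that skip_image[OF k] by auto
      then have "p (skip k i) \<le> Suc n + 1"
        using P by (auto simp: ptree_def PiE_def Pi_def)
      then show ?thesis
        using ps[OF that] k by (auto simp: skip_def split: if_splits)
    qed
    moreover have "?c n p' i" if "i \<in> {1..n}" for i
    proof -
      have "skip k i \<in> {1..Suc n}"
        using that skip_image[OF k] by auto
      then have "?c (Suc n) p (skip k i)"
        using P unfolding ptree_def by blast
      then show ?thesis
        using step[OF that rng[OF that]] by blast
    qed
    ultimately show "ptree n p'"
      using p' by (auto simp: ptree_def PiE_def Pi_def)
  }
  {
    assume P: "ptree n p'"
    have rng: "p' i \<le> n + 1" if "i \<in> {1..n}" for i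
      using that P by (auto simp: ptree_def PiE_def Pi_def)
    have neq: "p' i \<noteq> i" if "i \<in> {1..n}" for i
      using that P by (auto simp: ptree_def)
    have ck: "?c (Suc n) p k"
      using adjacent
    proof
      assume t: "t = Suc k"
      show ?thesis
      proof (cases "t = n + 2")
        case False
        then have "k \<in> {1..n}" "p' k \<le> k"
          using t k nbr by auto
        then show ?thesis
          using ps[of k] neq[of k] t pk by (auto simp: skip_def)
      qed (use t pk in simp)
    next
      assume t: "k = Suc t"
      show ?thesis
      proof (cases "t = 0")
        case False
        then have "t \<in> {1..n}" "t \<le> p' t"
          using t k nbr by auto
        then show ?thesis
          using ps[of t] neq[of t] t pk by (auto simp: skip_def)
      qed (use t pk in simp)
    qed
    have "?c (Suc n) p i" if "i \<in> {1..Suc n}" for i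
    proof (cases "i = k")
      case False
      then obtain i' where i': "i = skip k i'" "i' \<in> {1..n}"
        using \<open>i \<in> {1..Suc n}\<close> unfolding skip_image[OF k] by blast
      have "?c n p' i'"
        using P i' unfolding ptree_def by blast
      then show ?thesis
        using step[OF i'(2) rng[OF i'(2)]] i'(1) by blast
    qed (use ck in simp)
    moreover have "p i \<le> Suc n + 1" if "i \<in> {1..Suc n}" for i
    proof (cases "i = k")
      case True
      then show ?thesis
        using pk adjacent k by auto
    next
      case False
      then obtain i' where "i = skip k i'" "i' \<in> {1..n}"
        using \<open>i \<in> {1..Suc n}\<close> unfolding skip_image[OF k] by blast
      then show ?thesis
        using ps[of i'] rng[of i'] by (auto simp: skip_def)
    qed
    ultimately show "ptree (Suc n) p"
      using p by (auto simp: ptree_def PiE_def Pi_def)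
  }
qed

end

text \<open>By alternation a child \<open>j\<close> of \<open>k\<close> would have to lie strictly
  between \<open>k\<close> and its own grandparent \<open>t\<close>, where there is no
  label.\<close>

lemma ptree_no_child_of_leaf:
  assumes "ptree n p" "k \<in> {1..n}" "p k = t" "t = Suc k \<or> k = Suc t" "j \<in> {1..n}"
  shows "p j \<noteq> k"
proof
  assume "p j = k"
  moreover have "p j \<noteq> j" "j < p j \<longrightarrow> p j = n + 1 \<or> p (p j) < j" "p j < j \<longrightarrow> p j = 0 \<or> j < p (p j)"
    using assms unfolding ptree_def by blast+
  ultimately show False
    using assms by auto
qed

text \<open>All three recurrences delete leaves through this bijection. The letter next to
  \<open>c\<close> gives \<open>t\<close> the kind opposite to that of \<open>k\<close>, or else
  \<open>t\<close> is the root or the top vertex, so \<open>k\<close> can be put back into every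
  tree for \<open>u @ v\<close>. Here \<open>n\<close> is the size after deletion, whence the top
  vertex \<open>n + 2\<close>.\<close>

lemma sum_ptree_leaf:
  assumes "k = length u + 1" and n: "n = length u + length v"
    and t: "t = Suc k \<and> c = 1 \<and> (v = [] \<or> hd v = 0) \<or> k = Suc t \<and> c = 0 \<and> (u = [] \<or> last u = 1)"
  shows "(\<Sum>p | ptree (Suc n) p \<and> pword (Suc n) p = u @ [c] @ v \<and> p k = t.
            weight x y z (Suc n) p * q ^ crossings (Suc n) p)
       = (if t = 0 then x else if t = n + 2 then y else z) * ptree_sum x y z q (u @ v)"
proof -
  let ?w = "if t = 0 then x else if t = n + 2 then y else z"
  define ins where "ins = (\<lambda>p'. \<lambda>j\<in>{1..Suc n}. if j = k then t else skip k (p' (unskip k j)))"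
  define del where "del = (\<lambda>p. \<lambda>i\<in>{1..n}. unskip k (p (skip k i)))"
  have k: "1 \<le> k" "k \<le> Suc n"
    using assms by auto
  have img: "skip k i \<in> {1..Suc n}" if "i \<in> {1..n}" for i
    using that skip_image[OF k] by auto
  have adj: "t = Suc k \<or> k = Suc t" and c: "c = (if k < t then 1 else 0)"
    using t by auto
  have len: "length u = k - 1" "length v = Suc n - k"
    using assms by auto
  have ins: "leaf_insertion n k t (ins p') p'" for p'
    using k adj img by unfold_locales (auto simp: ins_def)
  \<comment> \<open>Deletion relabels parents by \<open>unskip k\<close>, which
    \<open>skip k\<close> undoes only off the value \<open>k\<close>; hence \<open>k\<close> must be
    childless.\<close>
  have del: "leaf_insertion n k t p (del p)" if "ptree (Suc n) p" "p k = t" for p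
  proof -
    have "p (skip k i) \<noteq> k" if "i \<in> {1..n}" for i
      using ptree_no_child_of_leaf[OF \<open>ptree (Suc n) p\<close> _ \<open>p k = t\<close> adj img[OF that]] k by auto
    then show ?thesis
      using k adj that by unfold_locales (auto simp: del_def skip_unskip)
  qed
  \<comment> \<open>After the deletion the neighbour's letter in \<open>u @ v\<close> is
    \<open>hd v\<close> or \<open>last u\<close>, and it decides on which side its parent
    lies.\<close>
  have nbr: "t = Suc k \<Longrightarrow> t = n + 2 \<or> p' k \<le> k" "k = Suc t \<Longrightarrow> t = 0 \<or> t \<le> p' t"
    if "pword n p' = u @ v" for p'
  proof -
    have W: "(u @ v) ! (i - 1) = (if i < p' i then 1 else 0)" if "i \<in> {1..n}" for i
      using \<open>pword n p' = u @ v\<close> that unfolding pword_eq_iff by blast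
    show "t = n + 2 \<or> p' k \<le> k" if "t = Suc k"
    proof (cases "v = []")
      case False
      then have "k \<in> {1..n}"
        using assms by (cases v) auto
      moreover have "(u @ v) ! (k - 1) = 0"
        using False t that len by (auto simp: nth_append hd_conv_nth)
      ultimately have "(u @ v) ! (k - 1) = 0" "k \<in> {1..n}"
        by blast+
      then have "(if k < p' k then 1 else 0) = (0 :: nat)"
        using W by metis
      then show ?thesis
        by (cases "k < p' k") simp_all
    qed (use that assms(1) n in simp)
    show "t = 0 \<or> t \<le> p' t" if "k = Suc t"
    proof (cases "u = []")
      case False
      then have "t \<in> {1..n}"
        using assms that by (cases u) auto
      moreover have "(u @ v) ! (t - 1) = 1"
        using False t that len by (auto simp: nth_append last_conv_nth)
      ultimately have "(u @ v) ! (t - 1) = 1" "t \<in> {1..n}"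
        by blast+
      then have "(if t < p' t then 1 else 0) = (1 :: nat)"
        using W by metis
      then show ?thesis
        by (cases "t < p' t") simp_all
    qed (use that assms(1) n in simp)
  qed
  have ext: "ins p' \<in> extensional {1..Suc n}" "del p \<in> extensional {1..n}" for p p'
    unfolding ins_def del_def by (rule restrict_extensional)+
  have "(\<Sum>p | ptree (Suc n) p \<and> pword (Suc n) p = u @ [c] @ v \<and> p k = t.
            weight x y z (Suc n) p * q ^ crossings (Suc n) p)
      = (\<Sum>p' | ptree n p' \<and> pword n p' = u @ v. ?w * (weight x y z n p' * q ^ crossings n p'))"
  proof (rule sum.reindex_bij_witness[where i = ins and j = del])
    fix p assume "p \<in> {p. ptree (Suc n) p \<and> pword (Suc n) p = u @ [c] @ v \<and> p k = t}"
    then have p: "ptree (Suc n) p" "pword (Suc n) p = u @ [c] @ v" "p k = t"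
      by auto
    interpret leaf_insertion n k t p "del p"
      by (rule del[OF p(1,3)])
    have pext: "p \<in> extensional {1..Suc n}"
      using p(1) by (auto simp: ptree_def PiE_def)
    have w: "pword n (del p) = u @ v"
      using pword_insert[OF len] p(2) c by simp
    then show "del p \<in> {p'. ptree n p' \<and> pword n p' = u @ v}"
      using ptree_insert[OF pext ext(2) nbr[OF w]] p(1) by simp
    show "ins (del p) = p"
    proof (rule extensionalityI[OF ext(1) pext])
      fix j assume j: "j \<in> {1..Suc n}"
      show "ins (del p) j = p j"
      proof (cases "j = k")
        case False
        then obtain i where "j = skip k i" "i \<in> {1..n}"
          using j unfolding skip_image[OF k] by blast
        then show ?thesis
          using j ps[of i] by (simp add: ins_def)
      qed (use j p(3) in \<open>simp add: ins_def\<close>)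
    qed
    show "?w * (weight x y z n (del p) * q ^ crossings n (del p))
        = weight x y z (Suc n) p * q ^ crossings (Suc n) p"
      by (simp add: weight_insert crossings_insert mult.assoc)
  next
    fix p' assume "p' \<in> {p'. ptree n p' \<and> pword n p' = u @ v}"
    then have p': "ptree n p'" "pword n p' = u @ v"
      by auto
    interpret leaf_insertion n k t "ins p'" p'
      by (rule ins)
    have p'ext: "p' \<in> extensional {1..n}"
      using p'(1) by (auto simp: ptree_def PiE_def)
    show "ins p' \<in> {p. ptree (Suc n) p \<and> pword (Suc n) p = u @ [c] @ v \<and> p k = t}"
      using ptree_insert[OF ext(1) p'ext nbr[OF p'(2)]] p' pword_insert[OF len] c pk by simp
    show "del (ins p') = p'"
      by (rule extensionalityI[OF ext(2) p'ext]) (use ps in \<open>auto simp: del_def\<close>)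
  qed
  then show ?thesis
    by (simp add: ptree_sum_def n sum_distrib_left)
qed


subsection \<open>Exchanging adjacent labels\<close>

text \<open>No label lies between \<open>k\<close> and \<open>k + 1\<close>, so the exchange affects
  only the comparison of these two with each other.\<close>

lemma transpose_Suc_less_iff:
  assumes "{x, y} \<noteq> {k, Suc k}"
  shows "transpose k (Suc k) x < transpose k (Suc k) y \<longleftrightarrow> x < y"
  using assms by (auto simp: transpose_def doubleton_eq_iff split: if_splits)

text \<open>Conjugation by the transposition: the shape of the tree stays, only the two labels
  change places.\<close>

definition swap_tree :: "nat \<Rightarrow> nat \<Rightarrow> (nat \<Rightarrow> nat) \<Rightarrow> nat \<Rightarrow> nat" where
  "swap_tree n k p = (\<lambda>i\<in>{1..n}. transpose k (Suc k) (p (transpose k (Suc k) i)))"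

context
  fixes n k :: nat
  assumes k: "1 \<le> k" "Suc k \<le> n"
begin

private abbreviation \<tau> where "\<tau> \<equiv> transpose k (Suc k)"

lemma tau_mem: "\<tau> i \<in> {1..n} \<longleftrightarrow> i \<in> {1..n}"
  using k by (auto simp: transpose_def)

lemma tau_boundary [simp]: "\<tau> i = 0 \<longleftrightarrow> i = 0" "\<tau> i = Suc n \<longleftrightarrow> i = Suc n" "\<tau> i \<le> Suc n \<longleftrightarrow> i \<le> Suc n"
    "\<tau> i \<le> n \<longleftrightarrow> i \<le> n" "0 < \<tau> i \<longleftrightarrow> 0 < i" "Suc 0 \<le> \<tau> i \<longleftrightarrow> Suc 0 \<le> i"
  using k by (auto simp: transpose_def)

lemma swap_tree_tau: "i \<in> {1..n} \<Longrightarrow> swap_tree n k p (\<tau> i) = \<tau> (p i)"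
  using tau_mem[of i] by (simp add: swap_tree_def)

lemma swap_tree_k: "swap_tree n k p k = \<tau> (p (Suc k))" "swap_tree n k p (Suc k) = \<tau> (p k)"
  using swap_tree_tau[of k p] swap_tree_tau[of "Suc k" p] k by auto

lemma swap_tree_swap_tree: "p \<in> extensional {1..n} \<Longrightarrow> swap_tree n k (swap_tree n k p) = p"
  by (rule extensionalityI[where A = "{1..n}"])
    (auto simp: swap_tree_def)

lemma weight_swap_tree: "weight x y z n (swap_tree n k p) = weight x y z n p"
  unfolding weight_def
  by (rule prod.reindex_bij_witness[where i = \<tau> and j = \<tau>])
    (auto simp: swap_tree_def)

text \<open>Only a comparison of \<open>k\<close> with \<open>k + 1\<close> could flip, and
  \<open>F\<close> keeps these two from meeting as vertex and parent or as vertex and grandparent.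
  \<open>F\<close> admits both orientations so that the exchange can be inverted.\<close>

lemma ptree_swap_tree:
  assumes p: "ptree n p"
    and F: "Suc k < p k \<and> p (Suc k) < k \<or> p k < k \<and> Suc k < p (Suc k)"
  shows "ptree n (swap_tree n k p)"
proof -
  let ?c = "\<lambda>p i. p i \<noteq> i \<and> (i < p i \<longrightarrow> p i = n + 1 \<or> p (p i) < i) \<and>
                       (p i < i \<longrightarrow> p i = 0 \<or> i < (p::nat\<Rightarrow>nat) (p i))"
  let ?p = "swap_tree n k p"
  have c: "?c p i" if "i \<in> {1..n}" for i
    using p that unfolding ptree_def by blast
  have rng: "p i \<le> n + 1" if "i \<in> {1..n}" for i
    using p that by (auto simp: ptree_def PiE_def Pi_def)
  have c': "?c ?p (\<tau> i)" if i: "i \<in> {1..n}" for i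
  proof -
    have "{i, p i} \<noteq> {k, Suc k}"
      using F c[OF i] by (auto simp: doubleton_eq_iff)
    then have cmp: "\<tau> i < \<tau> (p i) \<longleftrightarrow> i < p i" "\<tau> (p i) < \<tau> i \<longleftrightarrow> p i < i"
      using transpose_Suc_less_iff[of i "p i"] transpose_Suc_less_iff[of "p i" i]
      by (auto simp: insert_commute)
    have "?p (\<tau> (p i)) < \<tau> i" if "i < p i" "p i \<noteq> n + 1"
    proof -
      have j: "p i \<in> {1..n}"
        using rng[OF i] that i by auto
      have "p (p i) < i"
        using c[OF i] that by blast
      \<comment> \<open>Were \<open>i\<close> and its grandparent the two labels, then
        \<open>i = k + 1\<close>, and \<open>i < p i\<close> would select the second alternative of
        \<open>F\<close>. Alternation at \<open>p i\<close> would then ask for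
        \<open>p i < p k\<close>, against \<open>p k < k\<close>.\<close>
      moreover have "{p (p i), i} \<noteq> {k, Suc k}"
        using F c[OF i] c[OF j] that calculation k by (auto simp: doubleton_eq_iff)
      ultimately show ?thesis
        using transpose_Suc_less_iff swap_tree_tau[OF j] by metis
    qed
    moreover have "\<tau> i < ?p (\<tau> (p i))" if "p i < i" "p i \<noteq> 0"
    proof -
      have j: "p i \<in> {1..n}"
        using that i by auto
      have "i < p (p i)"
        using c[OF i] that by blast
      moreover have "{i, p (p i)} \<noteq> {k, Suc k}"
        using F c[OF i] c[OF j] that calculation k by (auto simp: doubleton_eq_iff)
      ultimately show ?thesis
        using transpose_Suc_less_iff swap_tree_tau[OF j] by metis
    qed
    moreover have "\<tau> (p i) = n + 1 \<longleftrightarrow> p i = n + 1" "\<tau> (p i) = 0 \<longleftrightarrow> p i = 0" "\<tau> (p i) = \<tau> i \<longleftrightarrow> p i = i"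
      by (simp_all add: inj_eq[OF inj_transpose])
    ultimately show ?thesis
      using cmp c[OF i] unfolding swap_tree_tau[OF i] by blast
  qed
  have "?c ?p i" "?p i \<le> n + 1" if "i \<in> {1..n}" for i
    using c'[of "\<tau> i"] swap_tree_tau[of "\<tau> i" p] rng[of "\<tau> i"] that tau_mem[of i]
    by simp_all
  then show ?thesis
    by (auto simp: ptree_def PiE_def Pi_def swap_tree_def)
qed

lemma pword_swap_tree:
  assumes w: "pword n p = u @ [x, y] @ v" and u: "k = length u + 1"
    and "p k \<noteq> Suc k" "p (Suc k) \<noteq> k"
  shows "pword n (swap_tree n k p) = u @ [y, x] @ v"
proof -
  have len: "n = length u + length v + 2"
    using w unfolding pword_eq_iff by simp
  have "(u @ [y, x] @ v) ! (i - 1) = (if i < swap_tree n k p i then 1 else 0)" if i: "i \<in> {1..n}" for i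
  proof -
    have i': "\<tau> i \<in> {1..n}"
      using i tau_mem by blast
    have "(u @ [y, x] @ v) ! (i - 1) = (u @ [x, y] @ v) ! (\<tau> i - 1)"
      using i u by (auto simp: transpose_def nth_append nth_Cons split: nat.splits)
    also have "\<dots> = (if \<tau> i < p (\<tau> i) then 1 else 0)"
      using w i' unfolding pword_eq_iff by blast
    also have "{\<tau> i, p (\<tau> i)} \<noteq> {k, Suc k}"
      using assms by (auto simp: doubleton_eq_iff)
    then have "\<tau> i < p (\<tau> i) \<longleftrightarrow> i < swap_tree n k p i"
      using transpose_Suc_less_iff[of "\<tau> i" "p (\<tau> i)" k] swap_tree_tau[OF i', of p] by simp
    finally show ?thesis .
  qed
  then show ?thesis
    unfolding pword_eq_iff using len by simp
qed

text \<open>In \<open>p\<close> the parents of \<open>k\<close> and \<open>k + 1\<close> lie across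
  each other, so \<open>(k, k + 1)\<close> is counted; after the exchange each lies on its own outer
  side and the pair is lost. In every other counted pair no comparison is between the two
  labels.\<close>

lemma crossings_swap_tree:
  assumes p: "ptree n p" and F: "Suc k < p k" "p (Suc k) < k"
  shows "crossings n p = Suc (crossings n (swap_tree n k p))"
proof -
  let ?p = "swap_tree n k p"
  let ?C = "\<lambda>p. {(i, j). 1 \<le> i \<and> i < j \<and> j \<le> n \<and> p j < i \<and> j < (p::nat\<Rightarrow>nat) i}"
  have pext: "p \<in> extensional {1..n}"
    using p by (auto simp: ptree_def PiE_def)
  have p': "ptree n ?p"
    using ptree_swap_tree p F by blast
  have F': "?p k < k" "Suc k < ?p (Suc k)"
    using F unfolding swap_tree_k by (auto simp: transpose_def)
  have fin: "finite (?C p)" for p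
    by (rule finite_subset[where B = "{1..n} \<times> {1..n}"]) auto
  have p_tau: "p (\<tau> i) = \<tau> (?p i)" if "i \<in> {1..n}" for i
    using swap_tree_tau[OF that, of "?p"] swap_tree_swap_tree[OF pext] by simp
  have "?C p = insert (k, Suc k) (map_prod \<tau> \<tau> ` ?C ?p)"
  proof (intro equalityI subsetI)
    fix z assume "z \<in> ?C p"
    then obtain i j where z: "z = (i, j)" and ij: "1 \<le> i" "i < j" "j \<le> n" "p j < i" "j < p i"
      by auto
    have mem: "i \<in> {1..n}" "j \<in> {1..n}"
      using ij by auto
    show "z \<in> insert (k, Suc k) (map_prod \<tau> \<tau> ` ?C ?p)"
    proof (cases "z = (k, Suc k)")
      case False
      then have "{i, j} \<noteq> {k, Suc k}" "{p j, i} \<noteq> {k, Suc k}" "{j, p i} \<noteq> {k, Suc k}"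
        using ij F z by (auto simp: doubleton_eq_iff)
      then have "\<tau> i < \<tau> j" "?p (\<tau> j) < \<tau> i" "\<tau> j < ?p (\<tau> i)"
        using ij transpose_Suc_less_iff unfolding swap_tree_tau[OF mem(1)] swap_tree_tau[OF mem(2)]
        by blast+
      moreover have "\<tau> i \<in> {1..n}" "\<tau> j \<in> {1..n}"
        using mem tau_mem by blast+
      ultimately have "(\<tau> i, \<tau> j) \<in> ?C ?p"
        by auto
      then show ?thesis
        unfolding z by (intro insertI2 image_eqI[where x = "(\<tau> i, \<tau> j)"]) simp_all
    qed simp
  next
    fix z assume z: "z \<in> insert (k, Suc k) (map_prod \<tau> \<tau> ` ?C ?p)"
    show "z \<in> ?C p"
    proof (cases "z = (k, Suc k)")
      case True
      then show ?thesis
        using F k by auto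
    next
      case False
      then obtain i j where z: "z = (\<tau> i, \<tau> j)"
        and ij: "1 \<le> i" "i < j" "j \<le> n" "?p j < i" "j < ?p i"
        using z by auto
      have mem: "i \<in> {1..n}" "j \<in> {1..n}"
        using ij by auto
      \<comment> \<open>For this inclusion alternation at \<open>i\<close> and \<open>j\<close> is
        used: it excludes that \<open>j\<close> has parent \<open>k\<close> while
        \<open>i = k + 1\<close>, and that \<open>i\<close> has parent \<open>k + 1\<close> while
        \<open>j = k\<close>.\<close>
      have ci: "?p i = n + 1 \<or> ?p (?p i) < i" and cj: "?p j = 0 \<or> j < ?p (?p j)"
        using p' mem ij unfolding ptree_def by (meson order.strict_trans)+
      have "{i, j} \<noteq> {k, Suc k}" "{?p j, i} \<noteq> {k, Suc k}" "{j, ?p i} \<noteq> {k, Suc k}"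
        using ij F' ci cj k by (auto simp: doubleton_eq_iff)
      then have "\<tau> i < \<tau> j" "p (\<tau> j) < \<tau> i" "\<tau> j < p (\<tau> i)"
        using ij transpose_Suc_less_iff unfolding p_tau[OF mem(1)] p_tau[OF mem(2)]
        by blast+
      moreover have "\<tau> i \<in> {1..n}" "\<tau> j \<in> {1..n}"
        using mem tau_mem by blast+
      ultimately show ?thesis
        unfolding z by auto
    qed
  qed
  moreover have "(k, Suc k) \<notin> map_prod \<tau> \<tau> ` ?C ?p"
  proof
    assume "(k, Suc k) \<in> map_prod \<tau> \<tau> ` ?C ?p"
    then obtain i j where "k = \<tau> i" "Suc k = \<tau> j" "i < j"
      by auto
    then show False
      by (auto simp: transpose_def split: if_splits)
  qed
  moreover have "inj_on (map_prod \<tau> \<tau>) A" for A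
    by (rule inj_on_subset[OF map_prod_inj_on]) (rule inj_transpose inj_transpose subset_UNIV | simp)+
  ultimately show ?thesis
    using fin[of ?p] by (simp add: crossings_def card_image)
qed

end

text \<open>In a tree for the word with \<open>01\<close> the parent of \<open>k\<close> lies below
  \<open>k\<close> and that of \<open>k + 1\<close> above \<open>k + 1\<close>, so neither is the
  parent of the other. Therefore the restricted sum for \<open>10\<close> matches the full sum for
  \<open>01\<close>.\<close>

lemma sum_ptree_swap:
  assumes u: "k = length u + 1" and n: "n = length u + length v + 2"
  shows "(\<Sum>p | ptree n p \<and> pword n p = u @ [1, 0] @ v \<and> p k \<noteq> Suc k \<and> p (Suc k) \<noteq> k.
            weight x y z n p * q ^ crossings n p)
       = q * ptree_sum x y z q (u @ [0, 1] @ v)"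
proof -
  have k: "1 \<le> k" "Suc k \<le> n"
    using assms by auto
  have mem: "k \<in> {1..n}" "Suc k \<in> {1..n}"
    using k by auto
  have ext: "p \<in> extensional {1..n}" if "ptree n p" for p
    using that by (auto simp: ptree_def PiE_def)
  have F: "Suc k < p k" "p (Suc k) < k"
    if "ptree n p" "pword n p = u @ [1, 0] @ v" "p k \<noteq> Suc k" "p (Suc k) \<noteq> k" for p
  proof -
    have "(u @ [1, 0] @ v) ! (i - 1) = (if i < p i then 1 else 0)" if "i \<in> {1..n}" for i
      using \<open>pword n p = _\<close> that unfolding pword_eq_iff by blast
    from this[OF mem(1)] this[OF mem(2)] have "k < p k" "\<not> Suc k < p (Suc k)"
      using u by (cases "k < p k"; cases "Suc k < p (Suc k)"; simp add: nth_append)+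
    moreover have "p (Suc k) \<noteq> Suc k"
      using \<open>ptree n p\<close> mem unfolding ptree_def by blast
    ultimately show "Suc k < p k" "p (Suc k) < k"
      using that by linarith+
  qed
  have G: "p k < k" "Suc k < p (Suc k)" if "ptree n p" "pword n p = u @ [0, 1] @ v" for p
  proof -
    have "(u @ [0, 1] @ v) ! (i - 1) = (if i < p i then 1 else 0)" if "i \<in> {1..n}" for i
      using \<open>pword n p = _\<close> that unfolding pword_eq_iff by blast
    from this[OF mem(1)] this[OF mem(2)] have "\<not> k < p k" "Suc k < p (Suc k)"
      using u by (cases "k < p k"; cases "Suc k < p (Suc k)"; simp add: nth_append)+
    moreover have "p k \<noteq> k"
      using \<open>ptree n p\<close> mem unfolding ptree_def by blast
    ultimately show "p k < k" "Suc k < p (Suc k)"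
      by linarith+
  qed
  have "(\<Sum>p | ptree n p \<and> pword n p = u @ [1, 0] @ v \<and> p k \<noteq> Suc k \<and> p (Suc k) \<noteq> k.
            weight x y z n p * q ^ crossings n p)
      = (\<Sum>p | ptree n p \<and> pword n p = u @ [0, 1] @ v. q * (weight x y z n p * q ^ crossings n p))"
  proof (rule sum.reindex_bij_witness[where i = "swap_tree n k" and j = "swap_tree n k"])
    fix p assume "p \<in> {p. ptree n p \<and> pword n p = u @ [1, 0] @ v \<and> p k \<noteq> Suc k \<and> p (Suc k) \<noteq> k}"
    then have p: "ptree n p" "pword n p = u @ [1, 0] @ v" "p k \<noteq> Suc k" "p (Suc k) \<noteq> k"
      by auto
    show "swap_tree n k (swap_tree n k p) = p"
      using swap_tree_swap_tree[OF k ext[OF p(1)]] .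
    show "swap_tree n k p \<in> {p. ptree n p \<and> pword n p = u @ [0, 1] @ v}"
      using ptree_swap_tree[OF k p(1)] F[OF p] pword_swap_tree[OF k p(2) u p(3,4)] by blast
    show "q * (weight x y z n (swap_tree n k p) * q ^ crossings n (swap_tree n k p))
        = weight x y z n p * q ^ crossings n p"
      unfolding weight_swap_tree[OF k] crossings_swap_tree[OF k p(1) F[OF p]]
      by (simp add: mult.left_commute)
  next
    fix p assume "p \<in> {p. ptree n p \<and> pword n p = u @ [0, 1] @ v}"
    then have p: "ptree n p" "pword n p = u @ [0, 1] @ v"
      by auto
    have neq: "p k \<noteq> Suc k" "p (Suc k) \<noteq> k"
      using G[OF p] by auto
    show "swap_tree n k (swap_tree n k p) = p"
      using swap_tree_swap_tree[OF k ext[OF p(1)]] .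
    have "swap_tree n k p k \<noteq> Suc k" "swap_tree n k p (Suc k) \<noteq> k"
      using G[OF p] unfolding swap_tree_k[OF k] by (auto simp: transpose_def)
    then show "swap_tree n k p \<in> {p. ptree n p \<and> pword n p = u @ [1, 0] @ v \<and> p k \<noteq> Suc k \<and> p (Suc k) \<noteq> k}"
      using ptree_swap_tree[OF k p(1)] G[OF p] pword_swap_tree[OF k p(2) u neq] by blast
  qed
  then show ?thesis
    by (simp add: ptree_sum_def n sum_distrib_left)
qed

section \<open>Recurrences for the weighted sums over parent functions\<close>

lemma ptree_sum_swap:
  "ptree_sum x y z q (u @ [1, 0] @ v)
     = q * ptree_sum x y z q (u @ [0, 1] @ v) + z * ptree_sum x y z q (u @ [1] @ v) + z * ptree_sum x y z q (u @ [0] @ v)"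
proof -
  define k where "k = length u + 1"
  define n where "n = length u + length v + 2"
  let ?f = "\<lambda>p. weight x y z n p * q ^ crossings n p"
  let ?S = "\<lambda>P. {p. ptree n p \<and> pword n p = u @ [1, 0] @ v \<and> P p}"
  have split: "?S (\<lambda>p. True) = ?S (\<lambda>p. p k \<noteq> Suc k \<and> p (Suc k) \<noteq> k)
      \<union> ?S (\<lambda>p. p (Suc k) = k) \<union> ?S (\<lambda>p. p k = Suc k)"
    by blast
  \<comment> \<open>Two vertices that are parents of each other would form a cycle; alternation at
    \<open>k + 1\<close> rules it out.\<close>
  have disj: "?S (\<lambda>p. p (Suc k) = k) \<inter> ?S (\<lambda>p. p k = Suc k) = {}"
  proof -
    have "Suc k < Suc k" if "ptree n p" "p (Suc k) = k" "p k = Suc k" for p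
    proof -
      have "Suc k \<in> {1..n}"
        by (simp add: k_def n_def)
      then have "p (Suc k) < Suc k \<longrightarrow> p (Suc k) = 0 \<or> Suc k < p (p (Suc k))"
        using that(1) unfolding ptree_def by blast
      then show ?thesis
        using that(2,3) by (simp add: k_def)
    qed
    then show ?thesis
      by blast
  qed
  have "ptree_sum x y z q (u @ [1, 0] @ v) = sum ?f (?S (\<lambda>p. True))"
    by (simp add: ptree_sum_def n_def)
  also have "\<dots> = sum ?f (?S (\<lambda>p. p k \<noteq> Suc k \<and> p (Suc k) \<noteq> k))
      + sum ?f (?S (\<lambda>p. p (Suc k) = k)) + sum ?f (?S (\<lambda>p. p k = Suc k))"
  proof -
    have "(?S (\<lambda>p. p k \<noteq> Suc k \<and> p (Suc k) \<noteq> k) \<union> ?S (\<lambda>p. p (Suc k) = k)) \<inter> ?S (\<lambda>p. p k = Suc k) = {}"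
      "?S (\<lambda>p. p k \<noteq> Suc k \<and> p (Suc k) \<noteq> k) \<inter> ?S (\<lambda>p. p (Suc k) = k) = {}"
      using disj by blast+
    then show ?thesis
      unfolding split by (simp add: sum.union_disjoint finite_ptree)
  qed
  also have "sum ?f (?S (\<lambda>p. p k \<noteq> Suc k \<and> p (Suc k) \<noteq> k)) = q * ptree_sum x y z q (u @ [0, 1] @ v)"
    by (rule sum_ptree_swap[OF k_def n_def])
  \<comment> \<open>Here \<open>k + 1\<close> is the leaf and its letter \<open>0\<close>
    disappears; its parent \<open>k\<close> is neither \<open>0\<close> nor the top vertex, which
    gives the weight \<open>z\<close>.\<close>
  also have "sum ?f (?S (\<lambda>p. p (Suc k) = k)) = z * ptree_sum x y z q (u @ [1] @ v)"
    using sum_ptree_leaf[of "Suc k" "u @ [1]" "n - 1" v k 0 x y z q] by (simp add: k_def n_def)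
  \<comment> \<open>Here \<open>k\<close> is the leaf, its letter \<open>1\<close> disappears, and
    its parent is the inner vertex \<open>k + 1\<close>.\<close>
  also have "sum ?f (?S (\<lambda>p. p k = Suc k)) = z * ptree_sum x y z q (u @ [0] @ v)"
    using sum_ptree_leaf[of k u "n - 1" "[0] @ v" "Suc k" 1 x y z q] by (simp add: k_def n_def)
  finally show ?thesis .
qed

lemma ptree_sum_left: "ptree_sum x y z q ([0] @ v) = x * ptree_sum x y z q v"
proof -
  let ?n = "Suc (length v)"
  \<comment> \<open>A non-excedance has a smaller parent, which for the vertex \<open>1\<close>
    leaves only the root.\<close>
  have "p 1 = 0" if "ptree ?n p" "pword ?n p = [0] @ v" for p
  proof -
    have "1 \<in> {1..?n}"
      by simp
    then have "([0] @ v) ! (1 - 1) = (if 1 < p 1 then 1 else 0)" "p 1 \<noteq> 1"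
      using that unfolding pword_eq_iff ptree_def by blast+
    then show ?thesis
      by (cases "1 < p 1") simp_all
  qed
  then have "{p. ptree ?n p \<and> pword ?n p = [0] @ v}
      = {p. ptree ?n p \<and> pword ?n p = [] @ [0] @ v \<and> p 1 = 0}"
    by auto
  then have "ptree_sum x y z q ([0] @ v) = (\<Sum>p | ptree ?n p \<and> pword ?n p = [] @ [0] @ v \<and> p 1 = 0.
      weight x y z ?n p * q ^ crossings ?n p)"
    by (simp add: ptree_sum_def)
  also have "\<dots> = x * ptree_sum x y z q v"
    using sum_ptree_leaf[of 1 "[]" "length v" v 0 0 x y z q] by simp
  finally show ?thesis .
qed

lemma ptree_sum_right: "ptree_sum x y z q (u @ [1]) = y * ptree_sum x y z q u"
proof -
  let ?n = "Suc (length u)"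
  \<comment> \<open>Only the top vertex exceeds the last inner vertex.\<close>
  have "p ?n = Suc ?n" if "ptree ?n p" "pword ?n p = u @ [1]" for p
  proof -
    have n: "?n \<in> {1..?n}"
      by simp
    then have "(u @ [1]) ! (?n - 1) = (if ?n < p ?n then 1 else 0)"
      using that unfolding pword_eq_iff by blast
    moreover have "p \<in> {1..?n} \<rightarrow>\<^sub>E {0..?n + 1}"
      using that(1) unfolding ptree_def by blast
    then have "p ?n \<le> ?n + 1"
      using PiE_mem[OF _ n] by fastforce
    ultimately show ?thesis
      by (cases "?n < p ?n") simp_all
  qed
  then have "{p. ptree ?n p \<and> pword ?n p = u @ [1]}
      = {p. ptree ?n p \<and> pword ?n p = u @ [1] @ [] \<and> p ?n = Suc ?n}"
    by auto
  then have "ptree_sum x y z q (u @ [1]) = (\<Sum>p | ptree ?n p \<and> pword ?n p = u @ [1] @ [] \<and> p ?n = Suc ?n.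
      weight x y z ?n p * q ^ crossings ?n p)"
    by (simp add: ptree_sum_def)
  also have "\<dots> = y * ptree_sum x y z q u"
    using sum_ptree_leaf[of ?n u "length u" "[]" "Suc ?n" 1 x y z q] by simp
  finally show ?thesis .
qed

subsection \<open>Trees as edge sets and their colourings\<close>

definition tree_edges :: "nat \<Rightarrow> (nat \<Rightarrow> nat) \<Rightarrow> (nat \<times> nat) set" where
  "tree_edges n p = insert (n + 1, 0) ((\<lambda>i. (i, p i)) ` {1..n})"

definition parent_fun :: "nat \<Rightarrow> (nat \<times> nat) set \<Rightarrow> nat \<Rightarrow> nat" where
  "parent_fun n E = (\<lambda>i\<in>{1..n}. parent E i)"

text \<open>Every non-root vertex lies below all its descendants or above all of them. Applied to
  the parent and the grandparent of \<open>x\<close>, this gives the local condition at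
  \<open>x\<close>.\<close>

lemma ptree_parent_fun:
  assumes E: "alternative_tree {0..n + 1} 0 E"
  shows "ptree n (parent_fun n E)" and "tree_edges n (parent_fun n E) = E"
proof -
  let ?p = "parent E"
  have E': "E \<subseteq> {0..n + 1} \<times> {0..n + 1}" "\<forall>y. (0, y) \<notin> E"
      "\<forall>x\<in>{0..n + 1} - {0}. \<exists>!y. (x, y) \<in> E" "\<forall>x\<in>{0..n + 1}. (x, 0) \<in> E\<^sup>*"
    and mono: "\<forall>x\<in>{0..n + 1} - {0}. ?p x < x \<longrightarrow> (\<forall>d\<in>descendants E x. d < x)"
      "\<forall>x\<in>{0..n + 1} - {0}. x < ?p x \<longrightarrow> (\<forall>d\<in>descendants E x. x < d)"
    using E unfolding alternative_tree_def rooted_tree_def by - (elim conjE, assumption)+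
  note sub = E'(1)
  have root: "(0, y) \<notin> E" for y
    using E'(2) by (rule spec)
  have ex1: "\<exists>!y. (x, y) \<in> E" if "x \<in> {0..n + 1} - {0}" for x
    using E'(3) that by (rule bspec)
  have reach: "(x, 0) \<in> E\<^sup>*" if "x \<in> {0..n + 1}" for x
    using E'(4) that by (rule bspec)
  have gt: "d < x" if "x \<in> {0..n + 1} - {0}" "?p x < x" "(d, x) \<in> E\<^sup>+" for x d
    using mono(1) that unfolding descendants_def by blast
  have lt: "x < d" if "x \<in> {0..n + 1} - {0}" "x < ?p x" "(d, x) \<in> E\<^sup>+" for x d
    using mono(2) that unfolding descendants_def by blast
  have edge: "(x, ?p x) \<in> E" if "x \<in> {0..n + 1} - {0}" for x
    unfolding parent_def using ex1[OF that] by (rule theI')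
  have edge_iff: "(x, y) \<in> E \<longleftrightarrow> x \<in> {0..n + 1} - {0} \<and> y = ?p x" for x y
  proof
    assume xy: "(x, y) \<in> E"
    have "x \<in> {0..n + 1}"
      using xy sub by blast
    moreover have "x \<noteq> 0"
      using xy root by metis
    ultimately have "x \<in> {0..n + 1} - {0}"
      by blast
    then show "x \<in> {0..n + 1} - {0} \<and> y = ?p x"
      using ex1 edge xy by blast
  qed (use edge in blast)
  have le: "?p x \<le> n + 1" if "x \<in> {0..n + 1} - {0}" for x
  proof -
    have "(x, ?p x) \<in> {0..n + 1} \<times> {0..n + 1}"
      using edge[OF that] sub by blast
    then show ?thesis
      by simp
  qed
  have neq: "?p x \<noteq> x" if x: "x \<in> {0..n + 1} - {0}" for x
  proof
    assume loop: "?p x = x"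
    have "(x, 0) \<in> E\<^sup>*"
      using x reach by blast
    then have "0 = x"
      by (induction rule: rtrancl_induct) (use loop edge_iff in auto)
    then show False
      using x by simp
  qed
  have desc1: "(x, ?p x) \<in> E\<^sup>+" if "x \<in> {0..n + 1} - {0}" for x
    using edge[OF that] by blast
  have desc2: "(x, ?p (?p x)) \<in> E\<^sup>+" if "x \<in> {0..n + 1} - {0}" "?p x \<noteq> 0" for x
    using le[OF that(1)] that(2) by (intro trancl_into_trancl[OF desc1[OF that(1)] edge]) simp
  \<comment> \<open>The parent exceeds its descendant \<open>x\<close>, so it exceeds its own parent
    too. The grandparent thus has a descendant above it; unless it is the root, it lies below all
    its descendants, in particular below \<open>x\<close>.\<close>
  have up: "?p (?p x) < x" if x: "x \<in> {1..n + 1}" "x < ?p x" "?p x \<noteq> n + 1" for x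
  proof -
    have x': "x \<in> {0..n + 1} - {0}"
      using x by auto
    have y: "?p x \<in> {0..n + 1} - {0}"
      using le[OF x'] x by auto
    have d2: "(x, ?p (?p x)) \<in> E\<^sup>+"
      using desc2[OF x'] x by auto
    have py: "?p (?p x) < ?p x"
      using lt[OF y _ desc1[OF x']] neq[OF y] x(2) by force
    show ?thesis
    proof (cases "?p (?p x) = 0")
      case False
      then have z: "?p (?p x) \<in> {0..n + 1} - {0}"
        using py le[OF x'] by auto
      then show ?thesis
        using gt[OF z _ desc1[OF y]] lt[OF z _ d2] neq[OF z] py by force
    qed (use x in simp)
  qed
  have down: "x < ?p (?p x)" if x: "x \<in> {1..n + 1}" "?p x < x" "?p x \<noteq> 0" for x
  proof -
    have x': "x \<in> {0..n + 1} - {0}"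
      using x by auto
    have y: "?p x \<in> {0..n + 1} - {0}"
      using le[OF x'] x by auto
    have d2: "(x, ?p (?p x)) \<in> E\<^sup>+"
      using desc2[OF x'] x by auto
    have py: "?p x < ?p (?p x)"
      using gt[OF y _ desc1[OF x']] neq[OF y] x(2) by force
    have z: "?p (?p x) \<in> {0..n + 1} - {0}"
      using py le[OF y] by auto
    show ?thesis
      using gt[OF z _ d2] lt[OF z _ desc1[OF y]] neq[OF z] py by force
  qed
  \<comment> \<open>Any parent other than \<open>0\<close> would force a grandparent above the
    largest label.\<close>
  have top: "?p (n + 1) = 0"
  proof (rule ccontr)
    assume "?p (n + 1) \<noteq> 0"
    moreover have "n + 1 \<in> {0..n + 1} - {0}"
      by auto
    ultimately have "n + 1 < ?p (?p (n + 1))" "?p (n + 1) \<in> {0..n + 1} - {0}"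
      using down[of "n + 1"] le[of "n + 1"] neq[of "n + 1"] by force+
    then show False
      using le[of "?p (n + 1)"] by simp
  qed
  let ?q = "parent_fun n E"
  have q: "?q x = ?p x" if "x \<in> {1..n}" for x
    using that by (simp add: parent_fun_def)
  have "?q x \<in> {0..n + 1}" "?q x \<noteq> x" "x < ?q x \<longrightarrow> ?q x = n + 1 \<or> ?q (?q x) < x"
    "?q x < x \<longrightarrow> ?q x = 0 \<or> x < ?q (?q x)" if x: "x \<in> {1..n}" for x
  proof -
    have x': "x \<in> {0..n + 1} - {0}" "x \<in> {1..n + 1}"
      using x by auto
    show "?q x \<in> {0..n + 1}" "?q x \<noteq> x"
      using le[OF x'(1)] neq[OF x'(1)] q[OF x] by simp_all
    show "x < ?q x \<longrightarrow> ?q x = n + 1 \<or> ?q (?q x) < x"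
      using up[OF x'(2)] le[OF x'(1)] q[OF x] q[of "?p x"] by force
    show "?q x < x \<longrightarrow> ?q x = 0 \<or> x < ?q (?q x)"
      using down[OF x'(2)] x q[OF x] q[of "?p x"] by force
  qed
  moreover have "?q \<in> extensional {1..n}"
    unfolding parent_fun_def by (rule restrict_extensional)
  ultimately show "ptree n ?q"
    unfolding ptree_def PiE_def Pi_def by blast
  have "tree_edges n ?q = (\<lambda>x. (x, ?p x)) ` ({0..n + 1} - {0})"
  proof -
    have "{0..n + 1} - {0} = insert (n + 1) {1..n}"
      by auto
    moreover have "(\<lambda>i. (i, ?q i)) ` {1..n} = (\<lambda>i. (i, ?p i)) ` {1..n}"
      by (rule image_cong[OF refl]) (simp only: q)
    ultimately show ?thesis
      by (simp only: tree_edges_def image_insert top)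
  qed
  then show "tree_edges n ?q = E"
    using edge_iff by (auto simp: image_iff)
qed

section \<open>From parent functions back to alternative trees\<close>

context
  fixes n :: nat and p :: "nat \<Rightarrow> nat"
  assumes p: "ptree n p"
begin

private abbreviation E where "E \<equiv> tree_edges n p"

lemma tree_edges_iff: "(x, y) \<in> E \<longleftrightarrow> x = n + 1 \<and> y = 0 \<or> x \<in> {1..n} \<and> y = p x"
  by (auto simp: tree_edges_def)

lemma parent_tree_edges: "parent E (n + 1) = 0" "i \<in> {1..n} \<Longrightarrow> parent E i = p i"
  unfolding parent_def by (rule the_equality; auto simp: tree_edges_iff)+

lemma ptreeD:
  assumes "i \<in> {1..n}"
  shows "p i \<le> n + 1" "p i \<noteq> i" "i < p i \<Longrightarrow> p i = n + 1 \<or> p (p i) < i" "p i < i \<Longrightarrow> p i = 0 \<or> i < p (p i)"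
proof -
  have "p i \<in> {0..n + 1}"
    using p assms PiE_mem unfolding ptree_def by blast
  then show "p i \<le> n + 1"
    by simp
qed (use p assms in \<open>unfold ptree_def, blast+\<close>)

lemma not_trancl_root: "(0, x) \<notin> E\<^sup>+"
  by (auto dest!: tranclD simp: tree_edges_iff)

lemma not_rtrancl_root: "(0, x) \<in> E\<^sup>* \<Longrightarrow> x = 0"
  using not_trancl_root by (metis rtranclD)

lemma not_trancl_top: "(n + 1, x) \<in> E\<^sup>+ \<Longrightarrow> x = 0"
  using not_rtrancl_root by (auto dest!: tranclD simp: tree_edges_iff)

text \<open>Acyclicity comes out of alternation: two steps up from a non-excedance lead to a larger
  non-excedance, unless \<open>0\<close> or \<open>n + 1\<close> is met before. An excedance is one
  step away from a non-excedance or from \<open>n + 1\<close>.\<close>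

lemma tree_edges_reach_root: "x \<le> n + 1 \<Longrightarrow> (x, 0) \<in> E\<^sup>*"
proof -
  have top: "(n + 1, 0) \<in> E\<^sup>*"
    by (rule r_into_rtrancl) (simp add: tree_edges_iff)
  have lower: "(x, 0) \<in> E\<^sup>*" if "x \<in> {1..n}" "p x < x" for x
    using that
  proof (induction "n + 1 - x" arbitrary: x rule: less_induct)
    case less
    have x: "(x, p x) \<in> E"
      using less.prems by (simp add: tree_edges_iff)
    show ?case
    proof (cases "p x = 0")
      case True
      then show ?thesis
        using x by auto
    next
      case False
      then have y: "p x \<in> {1..n}" "x < p (p x)"
        using less.prems ptreeD(4)[OF less.prems(1)] by auto
      then have "(p x, p (p x)) \<in> E"
        by (simp add: tree_edges_iff)
      with x have xy: "(x, p (p x)) \<in> E\<^sup>*"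
        by (rule rtrancl.rtrancl_into_rtrancl[OF r_into_rtrancl])
      show ?thesis
      proof (cases "p (p x) = n + 1")
        case True
        then show ?thesis
          using xy top by (metis rtrancl_trans)
      next
        case False
        have le: "p (p x) \<le> n"
          using False ptreeD(1)[OF y(1)] by simp
        have "p (p (p x)) < p x"
          using False ptreeD(3)[OF y(1)] y(2) less.prems by force
        then have "p (p (p x)) < p (p x)"
          using y(2) less.prems by simp
        then have "(p (p x), 0) \<in> E\<^sup>*"
          using less.hyps[of "p (p x)"] y(2) le less.prems by auto
        then show ?thesis
          using xy by (rule rtrancl_trans[rotated])
      qed
    qed
  qed
  assume "x \<le> n + 1"
  then consider "x = 0" | "x = n + 1" | "x \<in> {1..n}" "p x < x" | "x \<in> {1..n}" "x < p x"
    using ptreeD(2)[of x] by force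
  then show "(x, 0) \<in> E\<^sup>*"
  proof cases
    case 4
    have x: "(x, p x) \<in> E"
      using 4 by (simp add: tree_edges_iff)
    have "(p x, 0) \<in> E\<^sup>*"
    proof (cases "p x = n + 1")
      case False
      then have "p x \<in> {1..n}" "p (p x) < p x"
        using ptreeD(1)[OF 4(1)] ptreeD(3)[OF 4] 4 by auto
      then show ?thesis
        by (rule lower)
    qed (use top in simp)
    then show ?thesis
      using x by (rule converse_rtrancl_into_rtrancl[rotated])
  qed (use top lower in auto)
qed

lemma descendant_less:
  assumes x: "x \<in> {1..n}" "p x < x" and d: "(d, x) \<in> E\<^sup>+"
  shows "d < x"
proof -
  have edge: "(y, x') \<in> E \<Longrightarrow> (x', x) \<in> E\<^sup>* \<Longrightarrow> y \<in> {1..n} \<and> x' = p y" for y x'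
    using not_rtrancl_root[of x] x by (auto simp: tree_edges_iff)
  \<comment> \<open>The bound on the parent is the strengthening that carries the induction: a
    vertex above its parent is bounded only through its grandparent.\<close>
  have "d < x \<and> p d \<le> x"
    using d
  proof (induction rule: converse_trancl_induct)
    case (base y)
    then have y: "y \<in> {1..n}" "x = p y"
      using edge by blast+
    then show ?case
      using ptreeD(2,4)[OF y(1)] x by force
  next
    case (step d y)
    then have d: "d \<in> {1..n}" "y = p d"
      using edge by (meson trancl_into_rtrancl)+
    have "y \<noteq> 0"
      using step.hyps not_trancl_root by metis
    then show ?case
      using ptreeD(2,4)[OF d(1)] step.IH d by force
  qed
  then show ?thesis ..
qed

lemma descendant_greater:
  assumes x: "x \<in> {1..n}" "x < p x" and d: "(d, x) \<in> E\<^sup>+"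
  shows "x < d"
proof -
  have edge: "(y, x') \<in> E \<Longrightarrow> (x', x) \<in> E\<^sup>* \<Longrightarrow> y \<in> {1..n} \<and> x' = p y" for y x'
    using not_rtrancl_root[of x] x by (auto simp: tree_edges_iff)
  \<comment> \<open>Dual invariant: a vertex below its parent is bounded from below through its
    grandparent, provided the parent is not \<open>n + 1\<close>.\<close>
  have "x < d \<and> x \<le> p d"
    using d
  proof (induction rule: converse_trancl_induct)
    case (base y)
    then have y: "y \<in> {1..n}" "x = p y"
      using edge by blast+
    then show ?case
      using ptreeD(2,3)[OF y(1)] x by force
  next
    case (step d y)
    then have d: "d \<in> {1..n}" "y = p d"
      using edge by (meson trancl_into_rtrancl)+
    have "y \<noteq> n + 1"
      using step.hyps not_trancl_top x by force
    then show ?case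
      using ptreeD(2,3)[OF d(1)] step.IH d by force
  qed
  then show ?thesis ..
qed

lemma alternative_tree_tree_edges: "alternative_tree {0..n + 1} 0 E"
proof -
  have "\<exists>!y. (x, y) \<in> E" if "x \<in> {0..n + 1} - {0}" for x
    using that by (cases "x = n + 1") (auto simp: tree_edges_iff)
  moreover have "E \<subseteq> {0..n + 1} \<times> {0..n + 1}"
    using ptreeD(1) by (auto simp: tree_edges_iff)
  ultimately have "rooted_tree {0..n + 1} 0 E"
    unfolding rooted_tree_def using tree_edges_reach_root by (auto simp: tree_edges_iff)
  moreover have "0 = Min {0..n + 1}"
    by (rule Min_eqI[symmetric]) auto
  moreover have "(parent E x < x \<longrightarrow> (\<forall>d\<in>descendants E x. d < x))
      \<and> (x < parent E x \<longrightarrow> (\<forall>d\<in>descendants E x. x < d))" if x: "x \<in> {0..n + 1} - {0}" for x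
  proof (cases "x = n + 1")
    case True
    have "d < n + 1" if "(d, n + 1) \<in> E\<^sup>+" for d
    proof -
      have "d \<le> n + 1"
        using that by (auto dest!: tranclD simp: tree_edges_iff)
      moreover have "d \<noteq> n + 1"
        using that not_trancl_top by force
      ultimately show ?thesis
        by simp
    qed
    then show ?thesis
      unfolding True parent_tree_edges by (auto simp: descendants_def)
  next
    case False
    then have "x \<in> {1..n}"
      using x by auto
    then show ?thesis
      using parent_tree_edges(2) descendant_less descendant_greater
      by (auto simp: descendants_def simp del: atLeastAtMost_iff)
  qed
  ultimately show ?thesis
    unfolding alternative_tree_def by simp
qed

lemma parent_fun_tree_edges: "parent_fun n E = p"
proof (rule extensionalityI)
  show "parent_fun n E \<in> extensional {1..n}"
    unfolding parent_fun_def by (rule restrict_extensional)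
  show "p \<in> extensional {1..n}"
    using p by (auto simp: ptree_def PiE_def)
qed (simp add: parent_fun_def parent_tree_edges(2))

lemma children_tree_edges:
  "children E 0 = insert (n + 1) {i \<in> {1..n}. p i = 0}"
  "children E (n + 1) = {i \<in> {1..n}. p i = n + 1}"
  by (auto simp: children_def tree_edges_iff)

text \<open>A path through \<open>0\<close> or \<open>n + 1\<close> can only go on to
  \<open>0\<close> and never reaches the inner vertex \<open>x\<close>. Hence the colour constraint
  at the maximum of such a subtree does not collide with the prescribed colours of \<open>0\<close>,
  \<open>n + 1\<close> and the children of \<open>0\<close>.\<close>

lemma below_top_child:
  assumes x: "x \<in> {1..n}" "p x = n + 1" and m: "(m, x) \<in> E\<^sup>*"
  shows "m \<in> {1..n}" "p m \<noteq> 0"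
proof -
  have "m \<noteq> 0"
    using m x not_rtrancl_root[of x] by (cases "m = 0") auto
  moreover have "m \<noteq> n + 1"
    using m x not_trancl_top[of x] by (auto dest!: rtranclD)
  moreover have "m \<le> n + 1"
    using m by (rule converse_rtranclE) (use x in \<open>auto simp: tree_edges_iff\<close>)
  ultimately show mem: "m \<in> {1..n}"
    by simp
  show "p m \<noteq> 0"
    using m
  proof (rule converse_rtranclE)
    fix y assume "(m, y) \<in> E" "(y, x) \<in> E\<^sup>*"
    moreover from this have "y = p m"
      using mem by (auto simp: tree_edges_iff)
    ultimately show ?thesis
      using not_rtrancl_root[of x] x by (cases "p m = 0") auto
  qed (use x in simp)
qed

text \<open>Parents are unique, so two ancestors of \<open>m\<close> lie on one path, and above a
  child of \<open>n + 1\<close> that path contains only \<open>n + 1\<close> and \<open>0\<close>.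
  Thus subtrees at different children of \<open>n + 1\<close> have different maxima.\<close>

lemma top_child_unique:
  assumes x: "x \<in> {1..n}" "p x = n + 1" and y: "y \<in> {1..n}" "p y = n + 1"
    and m: "(m, x) \<in> E\<^sup>*" "(m, y) \<in> E\<^sup>*"
  shows "x = y"
proof -
  have no: "x = y" if "(x, y) \<in> E\<^sup>*" "x \<in> {1..n}" "p x = n + 1" "y \<in> {1..n}" for x y
    using that(1)
  proof (rule converse_rtranclE)
    fix z assume "(x, z) \<in> E" "(z, y) \<in> E\<^sup>*"
    then have "(n + 1, y) \<in> E\<^sup>*"
      using that by (auto simp: tree_edges_iff)
    then show ?thesis
      using that(4) not_trancl_top[of y] by (auto dest!: rtranclD)
  qed
  have "single_valued E"
    by (auto simp: single_valued_def tree_edges_iff)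
  then have "(x, y) \<in> E\<^sup>* \<or> (y, x) \<in> E\<^sup>*"
    using m by (rule single_valued_confluent)
  then show ?thesis
    using no x y by metis
qed

end

section \<open>Counting the colourings of a fixed tree\<close>

lemma prod_if_two:
  fixes x y z :: "'a::comm_monoid_mult"
  assumes "finite S" "K \<subseteq> S" "M \<subseteq> S" "K \<inter> M = {}"
  shows "(\<Prod>i\<in>S. if i \<in> K then x else if i \<in> M then y else z)
       = x ^ card K * y ^ card M * z ^ (card S - card K - card M)"
proof -
  let ?f = "\<lambda>i. if i \<in> K then x else if i \<in> M then y else z"
  have fin: "finite K" "finite M"
    using assms finite_subset by blast+
  have "prod ?f S = prod ?f (S - K - M) * prod ?f M * prod ?f K"
    using assms by (subst prod.subset_diff[of K S]; (subst prod.subset_diff[of M "S - K"])?) auto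
  moreover have "prod ?f K = x ^ card K"
    by simp
  moreover have "prod ?f M = (\<Prod>i\<in>M. y)"
    using assms(4) by (intro prod.cong) auto
  moreover have "prod ?f (S - K - M) = (\<Prod>i\<in>S - K - M. z)"
    by (intro prod.cong) auto
  moreover have "M \<subseteq> S - K"
    using assms by blast
  then have "card (S - K - M) = card S - card K - card M"
    using assms fin by (simp add: card_Diff_subset)
  ultimately show ?thesis
    by (simp add: ac_simps)
qed

lemma weight_eq:
  "weight x y z n p = x ^ card {i \<in> {1..n}. p i = 0} * y ^ card {i \<in> {1..n}. p i = n + 1}
     * z ^ (n - card {i \<in> {1..n}. p i = 0} - card {i \<in> {1..n}. p i = n + 1})"
proof -
  let ?K = "{i \<in> {1..n}. p i = 0}" and ?M = "{i \<in> {1..n}. p i = n + 1}"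
  have "weight x y z n p = (\<Prod>i\<in>{1..n}. if i \<in> ?K then x else if i \<in> ?M then y else z)"
    unfolding weight_def by (intro prod.cong) auto
  also have "\<dots> = x ^ card ?K * y ^ card ?M * z ^ (card {1..n} - card ?K - card ?M)"
    by (rule prod_if_two) auto
  finally show ?thesis
    by simp
qed

definition colourings :: "nat \<Rightarrow> nat \<Rightarrow> (nat \<Rightarrow> nat) \<Rightarrow> (nat \<Rightarrow> nat) set" where
  "colourings r n p = {c \<in> {0..n + 1} \<rightarrow>\<^sub>E {0..<r}.
     (\<forall>x \<in> children (tree_edges n p) 0. c x = 0) \<and>
     (\<forall>x \<in> children (tree_edges n p) (n + 1). c (Max (subtree_vertices (tree_edges n p) x)) \<noteq> 0) \<and>
     c 0 = 1 \<and> c (n + 1) = 0}"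

lemma card_colourings:
  assumes p: "ptree n p" and r: "r \<ge> 2"
  shows "card (colourings r n p) = (r - 1) ^ card {i \<in> {1..n}. p i = n + 1}
     * r ^ (n - card {i \<in> {1..n}. p i = 0} - card {i \<in> {1..n}. p i = n + 1})"
proof -
  let ?E = "tree_edges n p"
  let ?K0 = "{i \<in> {1..n}. p i = 0}" and ?K1 = "{i \<in> {1..n}. p i = n + 1}"
  define m where "m = (\<lambda>x. Max (subtree_vertices ?E x))"
  have m: "(m x, x) \<in> ?E\<^sup>*" if x: "x \<in> ?K1" for x
  proof -
    have sub: "subtree_vertices ?E x \<subseteq> {y. (y, x) \<in> ?E\<^sup>*}"
      by (auto simp: subtree_vertices_def descendants_def)
    also have "\<dots> \<subseteq> {1..n}"
      using below_top_child(1)[OF p] x by blast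
    finally have "finite (subtree_vertices ?E x)"
      by (rule finite_subset) simp
    then have "m x \<in> subtree_vertices ?E x"
      unfolding m_def by (intro Max_in) (auto simp: subtree_vertices_def)
    then show ?thesis
      using sub by blast
  qed
  have inj: "inj_on m ?K1"
  proof (rule inj_onI)
    fix x y assume xy: "x \<in> ?K1" "y \<in> ?K1" "m x = m y"
    then show "x = y"
      using top_child_unique[OF p, of x y "m x"] m[OF xy(1)] m[OF xy(2)] by auto
  qed
  have M: "m ` ?K1 \<subseteq> {1..n}" "?K0 \<inter> m ` ?K1 = {}"
    using below_top_child[OF p] m by blast+
  \<comment> \<open>Admissible colours vertex by vertex; by \<open>M\<close> the cases do not
    conflict, so the colourings form a full product.\<close>
  let ?F = "\<lambda>x. if x = 0 then {1} else if x = n + 1 then {0} else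
    if x \<in> ?K0 then {0} else if x \<in> m ` ?K1 then {1..<r} else {0..<r}"
  have "colourings r n p = PiE {0..n + 1} ?F"
  proof (intro equalityI subsetI)
    fix c assume c: "c \<in> colourings r n p"
    then have c1: "c \<in> {0..n + 1} \<rightarrow>\<^sub>E {0..<r}" "c 0 = 1" "c (n + 1) = 0" "\<forall>x\<in>?K0. c x = 0" "\<forall>x\<in>?K1. c (m x) \<noteq> 0"
      unfolding colourings_def children_tree_edges[OF p] m_def by auto
    show "c \<in> PiE {0..n + 1} ?F"
    proof (rule PiE_I)
      fix x assume "x \<in> {0..n + 1}"
      then have "c x \<in> {0..<r}"
        using c1(1) PiE_mem by blast
      then show "c x \<in> ?F x"
        using c1 by (auto simp: Suc_le_eq)
    next
      fix x assume "x \<notin> {0..n + 1}"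
      then show "c x = undefined"
        using c1(1) PiE_arb by blast
    qed
  next
    fix c assume c: "c \<in> PiE {0..n + 1} ?F"
    have mem: "c x \<in> ?F x" if "x \<in> {0..n + 1}" for x
      using c that by (rule PiE_mem)
    have "c \<in> {0..n + 1} \<rightarrow>\<^sub>E {0..<r}"
    proof (rule PiE_I)
      fix x assume "x \<in> {0..n + 1}"
      \<comment> \<open>The root has colour \<open>1\<close>, which lies in the range because
        \<open>r \<ge> 2\<close>.\<close>
      from mem[OF this] show "c x \<in> {0..<r}"
        using r by (auto split: if_splits)
    next
      fix x assume "x \<notin> {0..n + 1}"
      then show "c x = undefined"
        using c PiE_arb by blast
    qed
    moreover have "c 0 = 1" "c (n + 1) = 0"
      using mem[of 0] mem[of "n + 1"] by simp_all
    moreover have "c x = 0" if "x \<in> ?K0" for x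
      using mem[of x] that by auto
    moreover have "c (m x) \<noteq> 0" if x: "x \<in> ?K1" for x
    proof -
      have *: "m x \<in> m ` ?K1"
        using x by (rule imageI)
      then have "m x \<in> {1..n}" "m x \<notin> ?K0"
        using M by blast+
      then have "?F (m x) = {1..<r}"
        using * by simp
      then show ?thesis
        using mem[of "m x"] \<open>m x \<in> {1..n}\<close> by simp
    qed
    ultimately show "c \<in> colourings r n p"
      unfolding colourings_def children_tree_edges[OF p] m_def by auto
  qed
  then have "card (colourings r n p) = (\<Prod>x\<in>{0..n + 1}. card (?F x))"
    by (simp add: card_PiE)
  also have "{0..n + 1} = insert 0 (insert (n + 1) {1..n})"
    by auto
  also have "(\<Prod>x\<in>\<dots>. card (?F x)) = (\<Prod>x\<in>{1..n}. card (?F x))"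
    by simp
  also have "\<dots> = (\<Prod>x\<in>{1..n}. if x \<in> ?K0 then 1 else if x \<in> m ` ?K1 then r - 1 else r)"
    by (rule prod.cong) auto
  also have "\<dots> = 1 ^ card ?K0 * (r - 1) ^ card (m ` ?K1) * r ^ (card {1..n} - card ?K0 - card (m ` ?K1))"
    by (rule prod_if_two) (use M in auto)
  finally show ?thesis
    unfolding card_image[OF inj] by simp
qed

section \<open>From coloured trees to weighted parent functions\<close>

lemma statistics_tree_edges:
  assumes p: "ptree n p"
  defines "T \<equiv> \<lambda>c. \<lparr>inner = n, edges = tree_edges n p, col = c\<rparr>"
  shows "excedance_word (T c) = pword n p"
    and "c0 (T c) = card {i \<in> {1..n}. p i = 0}"
    and "c1 (T c) = card {i \<in> {1..n}. p i = n + 1}"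
    and "yy (T c) = crossings n p"
proof -
  show "excedance_word (T c) = pword n p"
    unfolding T_def excedance_word_def pword_def using parent_tree_edges(2)[OF p] by auto
  \<comment> \<open>The subtraction in \<open>c0\<close> removes the child \<open>n + 1\<close> and
    leaves the inner children of the root.\<close>
  show "c0 (T c) = card {i \<in> {1..n}. p i = 0}"
    unfolding T_def c0_def col_tree.simps children_tree_edges[OF p] by simp
  show "c1 (T c) = card {i \<in> {1..n}. p i = n + 1}"
    unfolding T_def c1_def col_tree.simps children_tree_edges[OF p] by simp
  show "yy (T c) = crossings n p"
    unfolding T_def yy_def crossings_def col_tree.simps
    by (intro arg_cong[where f = card] Collect_cong) (auto simp: parent_tree_edges(2)[OF p])
qed

text \<open>Decorated trees are pairs of a parent function and a colouring. Word and statistics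
  ignore the colours, so summing over the colourings multiplies each monomial by their number, which
  the second and third arguments of \<open>weight\<close> absorb.\<close>

lemma bracket_eq_ptree_sum:
  assumes r: "r \<ge> 2"
  shows "bracket r \<eta> = ptree_sum pa (pb * (of_nat r - 1)) (of_nat r) pq \<eta>"
proof -
  define n where "n = length \<eta>"
  let ?P = "{p. ptree n p \<and> pword n p = \<eta>}"
  let ?T = "\<lambda>(p, c). \<lparr>inner = n, edges = tree_edges n p, col = c\<rparr>"
  let ?I = "{T \<in> (\<Union>n. decorated_trees r n). excedance_word T = \<eta>}"
  let ?f = "\<lambda>T. pa ^ c0 T * pb ^ c1 T * pq ^ yy T"
  have I: "?I = ?T ` Sigma ?P (colourings r n)"
  proof (intro equalityI subsetI)
    fix T assume "T \<in> ?I"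
    then have T: "T \<in> decorated_trees r (inner T)" and w: "excedance_word T = \<eta>"
      by (auto simp: decorated_trees_def)
    have n: "inner T = n"
      using w by (auto simp: excedance_word_def n_def)
    define p where "p = parent_fun n (edges T)"
    have E: "alternative_tree {0..n + 1} 0 (edges T)"
      using T unfolding n decorated_trees_def by blast
    have p: "ptree n p" "tree_edges n p = edges T"
      unfolding p_def using ptree_parent_fun[OF E] by blast+
    have T_eq: "T = ?T (p, col T)"
      using n p(2) by simp
    have "pword n p = \<eta>"
      using statistics_tree_edges(1)[OF p(1), of "col T"] T_eq w by simp
    moreover have "col T \<in> colourings r n p"
      using T unfolding colourings_def p(2) n decorated_trees_def by blast
    ultimately show "T \<in> ?T ` Sigma ?P (colourings r n)"
      using p(1) by (intro rev_image_eqI[of "(p, col T)"]) (simp, rule T_eq)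
  next
    fix T assume "T \<in> ?T ` Sigma ?P (colourings r n)"
    then obtain p c where T: "T = ?T (p, c)" and p: "ptree n p" "pword n p = \<eta>" and c: "c \<in> colourings r n p"
      by auto
    have "T \<in> decorated_trees r n"
      using alternative_tree_tree_edges[OF p(1)] c unfolding T decorated_trees_def colourings_def by simp
    then show "T \<in> ?I"
      using statistics_tree_edges(1)[OF p(1), of c] p(2) T by auto
  qed
  have inj: "inj_on ?T (Sigma ?P (colourings r n))"
  proof (rule inj_onI, clarsimp)
    fix p p' assume "ptree n p" "ptree n p'" "tree_edges n p = tree_edges n p'"
    then show "p = p'"
      using parent_fun_tree_edges by metis
  qed
  have finite_colourings: "finite (colourings r n p)" for p
    unfolding colourings_def by (rule finite_subset[OF _ finite_PiE[of "{0..n + 1}" "\<lambda>_. {0..<r}"]]) auto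
  have "bracket r \<eta> = sum (?f \<circ> ?T) (Sigma ?P (colourings r n))"
    unfolding bracket_def I by (rule sum.reindex[OF inj])
  also have "\<dots> = (\<Sum>p\<in>?P. \<Sum>c\<in>colourings r n p. ?f (?T (p, c)))"
    by (subst sum.Sigma) (auto simp: finite_ptree finite_colourings intro!: sum.cong)
  also have "\<dots> = (\<Sum>p\<in>?P. weight pa (pb * (of_nat r - 1)) (of_nat r) n p * pq ^ crossings n p)"
  proof (rule sum.cong[OF refl])
    fix p assume "p \<in> ?P"
    then have p: "ptree n p"
      by blast
    let ?k0 = "card {i \<in> {1..n}. p i = 0}" and ?k1 = "card {i \<in> {1..n}. p i = n + 1}"
    have "(\<Sum>c\<in>colourings r n p. ?f (?T (p, c)))
        = of_nat (card (colourings r n p)) * (pa ^ ?k0 * pb ^ ?k1 * pq ^ crossings n p)"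
      unfolding prod.case statistics_tree_edges(2-4)[OF p] by simp
    \<comment> \<open>The count contains a difference of naturals; \<open>r \<ge> 2\<close> turns it
      into the ring element \<open>of_nat r - 1\<close>.\<close>
    also have "of_nat (card (colourings r n p)) = (of_nat r - 1 :: zpoly) ^ ?k1 * of_nat r ^ (n - ?k0 - ?k1)"
      unfolding card_colourings[OF p r] using r by (simp add: of_nat_diff)
    finally show "(\<Sum>c\<in>colourings r n p. ?f (?T (p, c)))
        = weight pa (pb * (of_nat r - 1)) (of_nat r) n p * pq ^ crossings n p"
      unfolding weight_eq by (simp add: power_mult_distrib ac_simps)
  qed
  finally show ?thesis
    by (simp add: ptree_sum_def n_def)
qed

theorem theorem4p2:
  fixes r :: nat and u v :: "nat list"
  assumes "r \<ge> 2" and "u \<in> lists {0, 1}" and "v \<in> lists {0, 1}"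
  shows "bracket r (u @ [1, 0] @ v) =
           pq * bracket r (u @ [0, 1] @ v)
           + of_nat r * bracket r (u @ [1] @ v) + of_nat r * bracket r (u @ [0] @ v) \<and>
         bracket r ([0] @ v) = pa * bracket r v \<and>
         bracket r (u @ [1]) = pb * (of_nat r - 1) * bracket r u"
  using ptree_sum_swap[of pa "pb * (of_nat r - 1)" "of_nat r" pq u v]
    ptree_sum_left[of pa "pb * (of_nat r - 1)" "of_nat r" pq v]
    ptree_sum_right[of pa "pb * (of_nat r - 1)" "of_nat r" pq u]
  unfolding bracket_eq_ptree_sum[OF assms(1)] by blast

end
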